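(* Let $t_1,t_2,t_3,t_4$ be nonzero complex numbers, $h'_i,l'_i$ ($i=1,2,3,4$), $\alpha',\mu_0,\alpha$ be complex parameters, and let $\xi\neq0$ be either independent of $x$ or of the form $\xi=Ax$ with $A$ independent of $x$. Assume that the function $h(s)$ satisfies $$A^{\langle 2 \rangle} \big( s; h'_1, h'_2, h'_3, h'_4, l'_1, l'_2, l'_3, l'_4, \alpha ' \big) h(s) = E' h(s)$$ and $$\lim _{L \to +\infty } \frac{h(s)}{s^{( h'_1 +h'_2 +h'_3 +h'_4 -l'_1-l'_2 -l'_3 -l'_4 - 2 \alpha ' +4)/2}} \Big| _{s=q^{L} \xi } = 0, \qquad \lim _{K \to -\infty } \frac{h(s)}{s^{-\alpha ' -1}} \Big| _{s=q^{K} \xi } = 0$$ for some constant $E'$. Set \begin{gather*} \chi = \big( l'_1 + l'_2 + l'_3 + l'_4 - h'_1 - h'_2 - h'_3 - h'_4 \big)/2 , \qquad E = q^{2 \mu _0 + \alpha - \alpha ' + \chi} E', \\ \mu = \mu _0 +1+ \chi, \qquad l_i = l'_i +\mu _0 , \qquad h_i = h'_i +\mu _0 +\chi , \qquad i=1,2,3,4. \end{gather*} Then the Jackson integral $$g (x) = x^{- \alpha } \int^{\xi \infty }_{0} s^{-( h'_1 +h'_2 +h'_3 +h'_4 -l'_1-l'_2 -l'_3 -l'_4 - 2 \alpha ' +2)/2} h(s) P^{(1)}_{\mu ,\mu _0 } (x,s)\, {\rm d}_{q}s$$ converges and it satisfies $$A^{\langle 2 \rangle} ( x; h_1, h_2,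 h_3, h_4, l_1, l_2, l_3, l_4 , \alpha ) g (x) = E g(x) .$$
   Context: $q$ is a complex number with $0<|q|<1$. Complex powers are taken with a fixed branch of $\log q$, so that $q^a=\exp(a\log q)$ and power functions obey $(q^{\pm1}x)^a=q^{\pm a}x^a$. Formulas are understood at points where all expressions are defined. Notation: $(a;q)_\infty=\prod_{j=0}^\infty(1-q^ja)$ and $$P^{(1)}_{\mu ,\mu _0 } (x,s)= \frac{(q^{\mu }s/x;q)_{\infty }}{(q^{\mu _0 }s/x;q)_{\infty }}.$$ The Jackson integral is the bilateral series $$\int^{\xi \infty }_{0}f(s)\, {\rm d}_{q}s = (1-q)\sum^{\infty}_{n=-\infty}q^{n} \xi f(q^n \xi ).$$ If $\xi=Ax$, replacing $x$ by $q^{\pm1}x$ in $g(x)$ also replaces $\xi$ by $q^{\pm1}\xi$. $T_x^{\pm1}$ is the $q$-shift operator, $T_x^{\pm1}g(x)=g(q^{\pm1}x)$. With fixed nonzero complex parameters $t_1,\dots,t_4$ (the same in all operators), \begin{gather*} A^{\langle 2 \rangle} ( x; h_1, h_2, h_3, h_4, l_1, l_2, l_3, l_4 , \alpha ) = x^{-2} \prod_{n=1}^4 (x- q^{h_n +1/2} t_n) T_{x}^{-1} + q^{2\alpha +1} x^{-2} \prod_{n=1}^4 (x- q^{l_n -1/2} t_n) T_{x} \\ {} + q^{\alpha +1/2} \Big[ -(q^{1/2} +q^{-1/2} ) x^2 + \sum _{n=1}^4 (q^{h_n}+ q^{l_n} ) t_n x \\ {} + \Big(\prod_{n=1}^4 q^{(h_n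 +l_n)/2} t_n\Big) \Big\{ - (q^{1/2} +q^{-1/2} ) x^{-2} + \sum _{n=1}^4 \Big( \frac{1}{q^{h_n}t_n} + \frac{1}{q^{l_n}t_n} \Big) x^{-1} \Big\} \Big], \end{gather*} and $A^{\langle 2 \rangle}(s;\dots)$ is the same operator in the variable $s$. *)

theory Defs
  imports "HOL-Analysis.Analysis"
begin

text \<open>
  Throughout, \<open>lq\<close> is the chosen value of \<open>log q\<close> (so \<open>exp lq = q\<close>), and all powers of \<open>q\<close> are
  taken with respect to it.
\<close>

definition q_power :: "complex \<Rightarrow> complex \<Rightarrow> complex" where
  "q_power lq a = exp (a * lq)"

text \<open>
  A choice of logarithm on the punctured plane that is compatible with the \<open>q\<close>-shift.  No continuity
  is asked for, because only the values along the orbits \<open>q\<^sup>n x\<close> matter; a branch that is analytic on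
  some \<open>q\<close>-invariant region and satisfies the shift rule there extends to such a function.
\<close>

definition q_logarithm :: "complex \<Rightarrow> (complex \<Rightarrow> complex) \<Rightarrow> bool" where
  "q_logarithm lq lg \<longleftrightarrow>
     (\<forall>x. x \<noteq> 0 \<longrightarrow> exp (lg x) = x \<and> lg (exp lq * x) = lg x + lq)"

definition branch_power :: "(complex \<Rightarrow> complex) \<Rightarrow> complex \<Rightarrow> complex \<Rightarrow> complex" where
  "branch_power lg x a = exp (a * lg x)"

lemma branch_power_q_shift:
  assumes "q_logarithm lq lg" "x \<noteq> 0"
  shows "branch_power lg (exp lq * x) a = q_power lq a * branch_power lg x a"
    and "branch_power lg (x / exp lq) a = q_power lq (- a) * branch_power lg x a"
proof -
  have 1: "lg (exp lq * y) = lg y + lq" if "y \<noteq> 0" for y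
    using assms(1) that by (simp add: q_logarithm_def)
  show "branch_power lg (exp lq * x) a = q_power lq a * branch_power lg x a"
    using 1[OF assms(2)]
    by (simp add: branch_power_def q_power_def exp_add [symmetric] algebra_simps)
  have "lg (x / exp lq) = lg x - lq"
    using 1[of "x / exp lq"] assms(2) by simp
  then have "a * lg (x / exp lq) = - a * lq + a * lg x"
    by (simp only: right_diff_distrib) simp
  then show "branch_power lg (x / exp lq) a = q_power lq (- a) * branch_power lg x a"
    by (simp only: branch_power_def q_power_def exp_add)
qed

lemma q_logarithm_exists:
  assumes "exp lq = q" "0 < norm q" "norm q < 1"
  shows "\<exists>lg. q_logarithm lq lg"
proof -
  define k where "k x = \<lfloor>ln (norm x) / ln (norm q)\<rfloor>" for x :: complex
  define lg where "lg x = of_int (k x) * lq + Ln (x / q powi k x)" for x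
  have q0: "q \<noteq> 0" and lnq: "ln (norm q) \<noteq> 0"
    using assms by auto
  have "exp (lg x) = x \<and> lg (exp lq * x) = lg x + lq" if x: "x \<noteq> 0" for x
  proof
    have "exp (of_int (k x) * lq) = q powi k x"
      using assms(1) exp_power_int[of lq "k x"] by simp
    then show "exp (lg x) = x"
      using x q0 by (simp add: lg_def exp_add)
    have "k (q * x) = k x + 1"
      using x q0 lnq by (simp add: k_def norm_mult ln_mult add_divide_distrib)
    then show "lg (exp lq * x) = lg x + lq"
      using q0 assms(1) by (simp add: lg_def power_int_add algebra_simps)
  qed
  then show ?thesis
    unfolding q_logarithm_def by blast
qed

definition q_invariant :: "complex \<Rightarrow> complex set \<Rightarrow> bool" where
  "q_invariant q D \<longleftrightarrow> 0 \<notin> D \<and> (\<forall>x\<in>D. q * x \<in> D \<and> x / q \<in> D)"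

definition q_poch_inf :: "complex \<Rightarrow> complex \<Rightarrow> complex" where
  "q_poch_inf a q = (\<Prod>j. 1 - q ^ j * a)"

definition kernel_P1 :: "complex \<Rightarrow> complex \<Rightarrow> complex \<Rightarrow> complex \<Rightarrow> complex \<Rightarrow> complex" where
  "kernel_P1 lq \<mu> \<mu>\<^sub>0 x s =
     q_poch_inf (q_power lq \<mu> * s / x) (exp lq) / q_poch_inf (q_power lq \<mu>\<^sub>0 * s / x) (exp lq)"

text \<open>
  For complex terms summability over the index set of all integers is absolute convergence of the
  bilateral series, so it implies convergence in every other usual sense, with the same value.
\<close>

definition jackson_convergent :: "complex \<Rightarrow> complex \<Rightarrow> (complex \<Rightarrow> complex) \<Rightarrow> bool" where
  "jackson_convergent q \<xi> f \<longleftrightarrow>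
     (\<lambda>n::int. q powi n * \<xi> * f (q powi n * \<xi>)) summable_on UNIV"

definition jackson_integral :: "complex \<Rightarrow> complex \<Rightarrow> (complex \<Rightarrow> complex) \<Rightarrow> complex" where
  "jackson_integral q \<xi> f =
     (1 - q) * (\<Sum>\<^sub>\<infinity>n::int. q powi n * \<xi> * f (q powi n * \<xi>))"

definition A2 ::
  "complex \<Rightarrow> (nat \<Rightarrow> complex) \<Rightarrow> (nat \<Rightarrow> complex) \<Rightarrow> (nat \<Rightarrow> complex) \<Rightarrow> complex
     \<Rightarrow> (complex \<Rightarrow> complex) \<Rightarrow> complex \<Rightarrow> complex" where
  "A2 lq t h l \<alpha> f x =
     (\<Prod>n=1..4. x - q_power lq (h n + 1/2) * t n) / x^2 * f (x / exp lq)
   + q_power lq (2 * \<alpha> + 1) * (\<Prod>n=1..4. x - q_power lq (l n - 1/2) * t n) / x^2 * f (exp lq * x)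
   + q_power lq (\<alpha> + 1/2) *
       (- (q_power lq (1/2) + q_power lq (- 1/2)) * x^2
        + (\<Sum>n=1..4. (q_power lq (h n) + q_power lq (l n)) * t n * x)
        + (\<Prod>n=1..4. q_power lq ((h n + l n) / 2) * t n) *
            (- (q_power lq (1/2) + q_power lq (- 1/2)) / x^2
             + (\<Sum>n=1..4. (1 / (q_power lq (h n) * t n) + 1 / (q_power lq (l n) * t n)) / x)))
     * f x"

end

theory Submission
  imports Defs
begin

text \<open>
  The kernel satisfies a pointwise identity.  Conjugated by \<open>x\<^bsup>-\<alpha>\<^esup>\<close>, the operator in \<open>x\<close> with the
  parameters \<open>h\<close>, \<open>l\<close> acts on \<open>P(x, s)\<close> as a three-term expression in \<open>P(x, q s)\<close>, \<open>P(x, s)\<close>,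
  \<open>P(x, s / q)\<close>, because \<open>P\<close> depends on \<open>s / x\<close> alone.  So does the formal adjoint, with respect to the
  Jackson measure and the weight in the integral, of the operator in \<open>s\<close> with the parameters \<open>h'\<close>, \<open>l'\<close>.
  The three values of the kernel have a common factor (\<open>kernel_P1_contiguous\<close>).  Once it is removed,
  the two expressions are rational functions, and they agree up to the power of \<open>q\<close> by which \<open>E\<close>
  differs from \<open>E'\<close> (\<open>kernel_coefficient_identity\<close>).  The choice of \<open>\<mu>\<close>, \<open>h\<close>, \<open>l\<close> is what makes
  this true; the form of the operator in which it can be seen is given by \<open>A2_normal_form\<close>.

  The equation for \<open>g\<close> then follows by summation by parts (\<open>lattice_sums_contiguous\<close>).  The adjoint is
  moved to \<open>h\<close>, where the equation \<open>A h = E' h\<close> applies, and what remains is a telescoping sum.  The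
  kernel tends to 1 as \<open>s\<close> tends to 0 along the lattice, and it behaves like \<open>s\<^bsup>-1 - chi\<^esup>\<close> at infinity.
  With the two limit conditions on \<open>h\<close> the terms of the Jackson integral are therefore \<open>o(s\<^sup>2)\<close> at
  zero and \<open>o(s\<^bsup>-2\<^esup>)\<close> at infinity (\<open>kernel_integrand_at_top\<close>, \<open>kernel_integrand_at_bot\<close>).  This
  gives absolute convergence.  The boundary terms carry in addition a coefficient of order
  \<open>s\<^bsup>-2\<^esup>\<close> at zero and \<open>s\<^sup>2\<close> at infinity, so they still tend to zero.  The telescoped pieces need not be
  summable separately, and the argument works with partial sums (\<open>bilateral_telescoping\<close>).

  If \<open>\<xi> = A x\<close>, a shift of \<open>x\<close> moves \<open>\<xi>\<close> along its own lattice and leaves the bilateral sum unchanged,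
  so both forms of \<open>\<xi>\<close> are treated on one fixed lattice.
\<close>

section \<open>Bilateral series\<close>

lemma int_nonneg_bij: "bij_betw int UNIV {0..}"
  by (rule bij_betwI[where g=nat]) auto

lemma int_neg_bij: "bij_betw (\<lambda>n. - int n) UNIV {..0}"
  by (rule bij_betwI[where g="\<lambda>n. nat (-n)"]) auto

lemma tendsto_int_at_top_iff:
  fixes f :: "int \<Rightarrow> 'a::topological_space"
  shows "(f \<longlongrightarrow> c) at_top \<longleftrightarrow> (\<lambda>n. f (int n)) \<longlonglongrightarrow> c"
  using filterlim_int_of_nat_at_topD[of f "nhds c"]
  by (auto intro: filterlim_compose[OF _ filterlim_int_sequentially])

lemma tendsto_int_at_bot_iff:
  fixes f :: "int \<Rightarrow> 'a::topological_space"
  shows "(f \<longlongrightarrow> c) at_bot \<longleftrightarrow> (\<lambda>n. f (- int n)) \<longlonglongrightarrow> c"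
  unfolding at_bot_mirror filterlim_filtermap
  by (rule tendsto_int_at_top_iff)

text \<open>
  The two halves of the series are dominated by the geometric series in \<open>norm r\<close>.
\<close>

lemma bilateral_summable_on:
  fixes f :: "int \<Rightarrow> complex"
  assumes r: "r \<noteq> 0" "norm r < 1"
    and top: "((\<lambda>n. f n / r powi n) \<longlongrightarrow> 0) at_top"
    and bot: "((\<lambda>n. f n * r powi n) \<longlongrightarrow> 0) at_bot"
  shows "f summable_on UNIV"
proof -
  have geo: "u summable_on UNIV" if "(\<lambda>n. u n / r ^ n) \<longlonglongrightarrow> 0" for u :: "nat \<Rightarrow> complex"
  proof (rule norm_summable_imp_summable_on)
    have "eventually (\<lambda>n. norm (u n / r ^ n) < 1) sequentially"
      using order_tendstoD(2)[OF tendsto_norm[OF that], of 1] by simp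
    then have "eventually (\<lambda>n. norm (norm (u n)) \<le> norm r ^ n) sequentially"
      using r by (auto elim!: eventually_mono simp: norm_divide norm_power field_simps)
    moreover have "summable (\<lambda>n. norm r ^ n)"
      using r by (intro summable_geometric) auto
    ultimately show "summable (\<lambda>n. norm (u n))"
      by (rule summable_comparison_test_ev)
  qed
  have "(\<lambda>n. f (int n)) summable_on UNIV"
    using top by (intro geo) (simp add: tendsto_int_at_top_iff power_int_of_nat)
  then have 1: "f summable_on {0..}"
    using summable_on_reindex_bij_betw[OF int_nonneg_bij, of f] by blast
  have "(\<lambda>n. f (- int n)) summable_on UNIV"
    using bot by (intro geo) (simp add: tendsto_int_at_bot_iff power_int_minus divide_inverse)
  then have 2: "f summable_on {..0}"
    using summable_on_reindex_bij_betw[OF int_neg_bij, of f] by blast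
  have "{0..} \<union> {..0::int} = UNIV"
    by auto
  with summable_on_union[OF 1 2] show ?thesis
    by simp
qed

text \<open>
  The symmetric intervals form a cofinal sequence of finite sets of integers.  This lets a sum over
  all integers be evaluated from partial sums whose pieces need not be summable one by one.
\<close>

lemma has_sum_int_symmetric_limit:
  fixes f :: "int \<Rightarrow> complex"
  assumes "(f has_sum c) UNIV"
  shows "(\<lambda>N. \<Sum>n\<in>{- int N..int N}. f n) \<longlonglongrightarrow> c"
proof -
  have "filterlim (\<lambda>N. {- int N..int N}) (finite_subsets_at_top UNIV) sequentially"
    unfolding filterlim_finite_subsets_at_top
  proof (intro allI impI)
    fix X :: "int set"
    assume "finite X \<and> X \<subseteq> UNIV"
    then have fin: "finite (abs ` X)"
      by simp
    show "\<forall>\<^sub>F N in sequentially. finite {- int N..int N} \<and> X \<subseteq> {- int N..int N} \<and> {- int N..int N} \<subseteq> UNIV"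
      using eventually_ge_at_top[of "nat (Max (abs ` X))"]
    proof eventually_elim
      case (elim N)
      have "\<bar>x\<bar> \<le> int N" if "x \<in> X" for x
        using Max_ge[OF fin, of "\<bar>x\<bar>"] that elim by simp
      then show ?case
        by (force simp: abs_le_iff)
    qed
  qed
  with assms show ?thesis
    unfolding has_sum_def by (rule filterlim_compose)
qed

text \<open>
  Here \<open>G\<close> itself may decay arbitrarily slowly; only the difference has to be summable.  This is the
  situation of the summation by parts below.
\<close>

lemma bilateral_telescoping:
  fixes f G :: "int \<Rightarrow> complex"
  assumes sum: "(f has_sum c) UNIV"
    and f: "\<And>n. f n = G (n + 1) - G n"
    and top: "(G \<longlongrightarrow> 0) at_top" and bot: "(G \<longlongrightarrow> 0) at_bot"
  shows "c = 0"
proof -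
  have *: "(\<Sum>n\<in>{- int N..int N}. f n) = G (int N + 1) - G (- int N)" for N
  proof (induction N)
    case 0
    then show ?case by (simp add: f)
  next
    case (Suc N)
    have "{- int (Suc N)..int (Suc N)} = insert (- 1 - int N) (insert (int N + 1) {- int N..int N})"
      by auto
    with Suc show ?case
      by (simp add: f add.commute)
  qed
  have "(\<lambda>N. G (int (Suc N))) \<longlonglongrightarrow> 0"
    using top LIMSEQ_Suc unfolding tendsto_int_at_top_iff by blast
  then have "(\<lambda>N. G (int N + 1)) \<longlonglongrightarrow> 0"
    by (simp add: add.commute)
  moreover have "(\<lambda>N. G (- int N)) \<longlonglongrightarrow> 0"
    using bot unfolding tendsto_int_at_bot_iff .
  ultimately have "(\<lambda>N. \<Sum>n\<in>{- int N..int N}. f n) \<longlonglongrightarrow> 0 - 0"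
    unfolding * by (rule tendsto_diff)
  with has_sum_int_symmetric_limit[OF sum] show ?thesis
    using LIMSEQ_unique by fastforce
qed

section \<open>Infinite q-Pochhammer symbols along a lattice\<close>

lemma convergent_prod_q_poch:
  fixes q a :: complex
  assumes "norm q < 1"
  shows "convergent_prod (\<lambda>j. 1 - q ^ j * a)"
proof (rule abs_convergent_prod_imp_convergent_prod, rule summable_imp_abs_convergent_prod)
  have "summable (\<lambda>j. norm q ^ j * norm a)"
    using assms by (intro summable_mult2 summable_geometric) auto
  then show "summable (\<lambda>i. norm (1 - q ^ i * a - 1))"
    by (simp add: norm_mult norm_power)
qed

lemma q_poch_inf_LIMSEQ:
  assumes "norm q < 1"
  shows "(\<lambda>n. \<Prod>j<n. 1 - q ^ j * a) \<longlonglongrightarrow> q_poch_inf a q"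
  using convergent_prod_LIMSEQ[OF convergent_prod_q_poch[OF assms]]
  unfolding q_poch_inf_def LIMSEQ_lessThan_iff_atMost .

lemma q_poch_inf_split:
  assumes "norm q < 1"
  shows "q_poch_inf a q = (\<Prod>j<n. 1 - q ^ j * a) * q_poch_inf (q ^ n * a) q"
proof -
  have "(\<lambda>k. \<Prod>j<k+n. 1 - q ^ j * a) \<longlonglongrightarrow> q_poch_inf a q"
    using q_poch_inf_LIMSEQ[OF assms] by (rule LIMSEQ_ignore_initial_segment)
  moreover have "(\<Prod>j<k+n. 1 - q ^ j * a)
      = (\<Prod>j<n. 1 - q ^ j * a) * (\<Prod>j<k. 1 - q ^ j * (q ^ n * a))" for k
    by (induction k) (simp_all add: power_add mult_ac)
  ultimately show ?thesis
    using LIMSEQ_unique[OF _ tendsto_mult_left[OF q_poch_inf_LIMSEQ[OF assms]]] by simp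
qed

lemma q_poch_inf_step:
  assumes "norm q < 1"
  shows "q_poch_inf a q = (1 - a) * q_poch_inf (q * a) q"
  using q_poch_inf_split[OF assms, of a 1] by simp

lemma q_poch_inf_nonzero:
  assumes "norm q < 1" "\<And>j. q ^ j * a \<noteq> 1"
  shows "q_poch_inf a q \<noteq> 0"
  unfolding q_poch_inf_def
  using assms by (intro prodinf_nonzero convergent_prod_q_poch) auto

text \<open>
  The tail of a convergent product tends to 1, provided that the product is nonzero.  Starting the
  product far enough out removes every vanishing factor.
\<close>

lemma q_poch_inf_tendsto_1:
  assumes q: "q \<noteq> 0" "norm q < 1"
  shows "((\<lambda>n. q_poch_inf (q powi n * a) q) \<longlongrightarrow> 1) at_top"
proof -
  have "(\<lambda>n. norm (q ^ n * a)) \<longlonglongrightarrow> 0"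
    using tendsto_mult_left_zero[OF LIMSEQ_power_zero[OF q(2)]] by (rule tendsto_norm_zero)
  then have "eventually (\<lambda>n. norm (q ^ n * a) < 1) sequentially"
    using order_tendstoD(2) zero_less_one by metis
  then obtain N where N: "norm (q ^ N * a) < 1"
    using eventually_happens by fastforce
  define b where "b = q ^ N * a"
  have "norm (q ^ j * b) < 1" for j
  proof -
    have "norm (q ^ j * b) \<le> 1 * norm b"
      unfolding norm_mult norm_power using q by (intro mult_right_mono power_le_one) auto
    with N show ?thesis by (simp add: b_def)
  qed
  then have b: "q ^ j * b \<noteq> 1" for j
    by (metis norm_one less_irrefl)
  note b0 = q_poch_inf_nonzero[OF q(2) b]
  have "(\<lambda>n. q_poch_inf b q / (\<Prod>j<n. 1 - q ^ j * b)) \<longlonglongrightarrow> q_poch_inf b q / q_poch_inf b q"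
    by (intro tendsto_divide tendsto_const q_poch_inf_LIMSEQ q b0)
  moreover have "q_poch_inf b q / (\<Prod>j<n. 1 - q ^ j * b) = q_poch_inf (q ^ n * b) q" for n
    using q_poch_inf_split[OF q(2), of b n] b by (simp add: field_simps)
  ultimately have "(\<lambda>n. q_poch_inf (q ^ (n + N) * a) q) \<longlonglongrightarrow> 1"
    using b0 by (simp add: b_def power_add mult_ac)
  then have "(\<lambda>n. q_poch_inf (q ^ n * a) q) \<longlonglongrightarrow> 1"
    by (rule LIMSEQ_offset)
  then show ?thesis
    by (simp add: tendsto_int_at_top_iff)
qed

text \<open>
  Towards infinity each step of the lattice contributes a factor
  \<open>(1 - a / q\<^sup>m) / (1 - b / q\<^sup>m) = (a / b) (1 - q\<^sup>m / a) / (1 - q\<^sup>m / b)\<close>.  The factors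
  \<open>a / b\<close> are the power growth, and the rest is a quotient of two convergent products.
\<close>

lemma q_poch_inf_ratio_at_bot:
  assumes q: "q \<noteq> 0" "norm q < 1" and ab: "a \<noteq> 0" "b \<noteq> 0"
    and nz: "\<And>n::int. q_poch_inf (q powi n * b) q \<noteq> 0"
  shows "\<exists>c. ((\<lambda>n. q_poch_inf (q powi n * a) q / q_poch_inf (q powi n * b) q * (a / b) powi n)
               \<longlongrightarrow> c) at_bot"
proof -
  define R where "R n = q_poch_inf (q powi n * a) q / q_poch_inf (q powi n * b) q * (a / b) powi n" for n
  have step: "q_poch_inf (q powi (- int (Suc n)) * d) q
      = - d / q ^ Suc n * (1 - q ^ n * (q / d)) * q_poch_inf (q powi (- int n) * d) q"
    if "d \<noteq> 0" for n d
  proof -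
    have qn: "q powi (- int (Suc n)) = inverse (q ^ Suc n)"
      by (simp only: power_int_minus power_int_of_nat)
    have "q * (q powi (- int (Suc n)) * d) = q powi (- int n) * d"
      unfolding qn using q by (simp add: power_int_minus field_simps)
    moreover have "1 - q powi (- int (Suc n)) * d = - d / q ^ Suc n * (1 - q ^ n * (q / d))"
      unfolding qn using q that by (simp add: field_simps)
    ultimately show ?thesis
      using q_poch_inf_step[OF q(2), of "q powi (- int (Suc n)) * d"] by (simp only:)
  qed
  have nzb: "1 - q ^ n * (q / b) \<noteq> 0" for n
    using nz[of "- int (Suc n)"] step[OF ab(2), of n] by auto
  have "R (- int n) = R 0 * ((\<Prod>j<n. 1 - q ^ j * (q / a)) / (\<Prod>j<n. 1 - q ^ j * (q / b)))" for n
  proof (induction n)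
    case 0
    then show ?case by simp
  next
    case (Suc n)
    have "R (- int (Suc n)) = R (- int n) * ((1 - q ^ n * (q / a)) / (1 - q ^ n * (q / b)))"
      unfolding R_def step[OF ab(1)] step[OF ab(2)]
      using q ab nzb[of n] nz[of "- int n"]
      by (simp add: power_int_minus power_divide del: of_nat_Suc) (simp add: divide_simps)
    with Suc show ?case
      by simp
  qed
  moreover have "(\<lambda>n. R 0 * ((\<Prod>j<n. 1 - q ^ j * (q / a)) / (\<Prod>j<n. 1 - q ^ j * (q / b)))) \<longlonglongrightarrow>
      R 0 * (q_poch_inf (q / a) q / q_poch_inf (q / b) q)"
    using nzb by (intro tendsto_mult_left tendsto_divide q_poch_inf_LIMSEQ q_poch_inf_nonzero q) auto
  ultimately show ?thesis
    unfolding tendsto_int_at_bot_iff R_def[symmetric] by auto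
qed

section \<open>Powers of q and of lattice points\<close>

lemma q_power_add: "q_power lq (a + b) = q_power lq a * q_power lq b"
  by (simp add: q_power_def exp_add distrib_right)

lemma q_power_minus: "q_power lq (- a) = 1 / q_power lq a"
  by (simp add: q_power_def exp_minus inverse_eq_divide)

lemma q_power_diff: "q_power lq (a - b) = q_power lq a / q_power lq b"
  by (simp add: q_power_def exp_diff left_diff_distrib)

lemma q_power_nonzero [simp]: "q_power lq a \<noteq> 0"
  by (simp add: q_power_def)

lemma q_power_1: "q_power lq 1 = exp lq"
  by (simp add: q_power_def)

lemma q_power_double: "q_power lq (2 * a) = (q_power lq a)\<^sup>2"
  by (simp add: q_power_def power2_eq_square mult.assoc flip: exp_add)

lemma q_power_half: "(q_power lq (1 / 2))\<^sup>2 = exp lq"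
  by (simp flip: q_power_double add: q_power_1)

lemma branch_power_add: "branch_power lg x (a + b) = branch_power lg x a * branch_power lg x b"
  by (simp add: branch_power_def exp_add distrib_right)

lemma branch_power_nonzero [simp]: "branch_power lg x a \<noteq> 0"
  by (simp add: branch_power_def)

lemma branch_power_1:
  assumes "q_logarithm lq lg" "x \<noteq> 0"
  shows "branch_power lg x 1 = x"
  using assms by (simp add: branch_power_def q_logarithm_def)

lemma branch_power_2:
  assumes "q_logarithm lq lg" "x \<noteq> 0"
  shows "branch_power lg x 2 = x\<^sup>2"
  using branch_power_add[of lg x 1 1] branch_power_1[OF assms] by (simp add: power2_eq_square)

lemma branch_power_powi:
  assumes lg: "q_logarithm lq lg" and x: "x \<noteq> 0"
  shows "branch_power lg (exp lq powi n * x) a = q_power lq a powi n * branch_power lg x a"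
proof (induction n rule: int_induct[where k = 0])
  case base
  then show ?case by simp
next
  case (step1 n)
  have "exp lq powi (n + 1) * x = exp lq * (exp lq powi n * x)"
    by (simp add: power_int_add mult_ac)
  then have "branch_power lg (exp lq powi (n + 1) * x) a
      = q_power lq a * branch_power lg (exp lq powi n * x) a"
    using x by (simp only:) (rule branch_power_q_shift(1)[OF lg], simp)
  with step1 show ?case
    by (simp add: power_int_add)
next
  case (step2 n)
  have "exp lq powi (n - 1) * x = exp lq powi n * x / exp lq"
    by (simp add: power_int_diff)
  with step2 x show ?case
    by (simp add: branch_power_q_shift(2)[OF lg] power_int_diff q_power_minus)
qed

section \<open>The operator in symmetric form\<close>

text \<open>
  The elementary symmetric polynomials in four quantities.  The kernel identity is linear in those
  of the two parameter families, and the last one of the second family is tied to the first.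
\<close>

definition sym1 :: "(nat \<Rightarrow> complex) \<Rightarrow> complex" where
  "sym1 u = u 1 + u 2 + u 3 + u 4"

definition sym2 :: "(nat \<Rightarrow> complex) \<Rightarrow> complex" where
  "sym2 u = u 1 * u 2 + u 1 * u 3 + u 1 * u 4 + u 2 * u 3 + u 2 * u 4 + u 3 * u 4"

definition sym3 :: "(nat \<Rightarrow> complex) \<Rightarrow> complex" where
  "sym3 u = u 1 * u 2 * u 3 + u 1 * u 2 * u 4 + u 1 * u 3 * u 4 + u 2 * u 3 * u 4"

definition sym4 :: "(nat \<Rightarrow> complex) \<Rightarrow> complex" where
  "sym4 u = u 1 * u 2 * u 3 * u 4"

lemma atLeastAtMost_1_4: "{1..4} = {1, 2, 3, 4::nat}"
  by auto

lemma prod_1_4: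
  fixes f :: "nat \<Rightarrow> complex"
  shows "(\<Prod>n=1..4. f n) = f 1 * f 2 * f 3 * f 4"
  unfolding atLeastAtMost_1_4 by simp

lemma sum_1_4:
  fixes f :: "nat \<Rightarrow> complex"
  shows "(\<Sum>n=1..4. f n) = f 1 + f 2 + f 3 + f 4"
  unfolding atLeastAtMost_1_4 by simp

lemma prod_linear_factors:
  "(\<Prod>n=1..4. x - c * u n) =
     x ^ 4 - c * sym1 u * x ^ 3 + c\<^sup>2 * sym2 u * x\<^sup>2 - c ^ 3 * sym3 u * x + c ^ 4 * sym4 u"
  unfolding prod_1_4 sym1_def sym2_def sym3_def sym4_def by algebra

text \<open>
  The coefficients of the operator in the variables \<open>u n = q\<^bsup>h n\<^esup> t n\<close> and \<open>v n = q\<^bsup>l n\<^esup> t n\<close>, with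
  \<open>Q = q\<^bsup>1/2\<^esup>\<close> and \<open>X = q\<^bsup>chi\<^esup>\<close>.  The reciprocals in the multiplication part combine with the product of
  the \<open>q\<^bsup>(h n + l n) / 2\<^esup> t n\<close> to third symmetric polynomials, since this product is \<open>X\<close> times
  \<open>u 1 u 2 u 3 u 4\<close> and also \<open>1 / X\<close> times \<open>v 1 v 2 v 3 v 4\<close>.
\<close>

definition heun_shift :: "complex \<Rightarrow> (nat \<Rightarrow> complex) \<Rightarrow> complex \<Rightarrow> complex" where
  "heun_shift c u x = (\<Prod>n=1..4. x - c * u n) / x\<^sup>2"

definition heun_mid ::
  "complex \<Rightarrow> complex \<Rightarrow> (nat \<Rightarrow> complex) \<Rightarrow> (nat \<Rightarrow> complex) \<Rightarrow> complex \<Rightarrow> complex" where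
  "heun_mid Q X u v x =
     - (Q + 1 / Q) * x\<^sup>2 + (sym1 u + sym1 v) * x
     + (X * sym3 u + sym3 v / X) / x - (Q + 1 / Q) * X * sym4 u / x\<^sup>2"

lemma sym4_balance:
  assumes chi: "chi = (l 1 + l 2 + l 3 + l 4 - h 1 - h 2 - h 3 - h 4) / 2"
  shows "sym4 (\<lambda>n. q_power lq (l n) * t n) = (q_power lq chi)\<^sup>2 * sym4 (\<lambda>n. q_power lq (h n) * t n)"
proof -
  have "l 1 + l 2 + l 3 + l 4 = 2 * chi + (h 1 + h 2 + h 3 + h 4)"
    unfolding chi by (simp add: field_simps del: One_nat_def)
  then have "q_power lq (l 1 + l 2 + l 3 + l 4) = q_power lq (2 * chi + (h 1 + h 2 + h 3 + h 4))"
    by simp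
  then show ?thesis
    unfolding sym4_def q_power_add q_power_double by (simp add: mult_ac del: One_nat_def)
qed

lemma A2_normal_form:
  fixes t h l lq \<alpha> chi
  defines "u \<equiv> \<lambda>n. q_power lq (h n) * t n" and "v \<equiv> \<lambda>n. q_power lq (l n) * t n"
    and "Q \<equiv> q_power lq (1 / 2)" and "A \<equiv> q_power lq \<alpha>" and "X \<equiv> q_power lq chi"
  assumes chi: "chi = (l 1 + l 2 + l 3 + l 4 - h 1 - h 2 - h 3 - h 4) / 2"
    and t: "\<And>i. i \<in> {1..4} \<Longrightarrow> t i \<noteq> 0"
  shows "A2 lq t h l \<alpha> f x =
      heun_shift Q u x * f (x / exp lq) + A\<^sup>2 * Q\<^sup>2 * heun_shift (1 / Q) v x * f (exp lq * x)
      + A * Q * heun_mid Q X u v x * f x"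
proof -
  have uv: "u n \<noteq> 0" "v n \<noteq> 0" if "n \<in> {1,2,3,4}" for n
    using that t by (auto simp: u_def v_def)
  have X: "X \<noteq> 0"
    by (simp add: X_def)
  have e4: "sym4 v = X\<^sup>2 * sym4 u"
    unfolding u_def v_def X_def by (rule sym4_balance[OF chi])
  have "(h 1 + l 1) / 2 + (h 2 + l 2) / 2 + (h 3 + l 3) / 2 + (h 4 + l 4) / 2
      = chi + (h 1 + h 2 + h 3 + h 4)"
    unfolding chi by (simp add: field_simps del: One_nat_def)
  then have "q_power lq ((h 1 + l 1) / 2 + (h 2 + l 2) / 2 + (h 3 + l 3) / 2 + (h 4 + l 4) / 2)
      = q_power lq (chi + (h 1 + h 2 + h 3 + h 4))"
    by simp
  then have R: "(\<Prod>n=1..4. q_power lq ((h n + l n) / 2) * t n) = X * sym4 u"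
    unfolding q_power_add prod_1_4 sym4_def u_def X_def by (simp add: mult_ac del: One_nat_def)
  have inv_u: "sym4 u * (\<Sum>n=1..4. 1 / u n) = sym3 u"
    unfolding sum_1_4 sym3_def sym4_def
    using uv[of 1] uv[of 2] uv[of 3] uv[of 4] by (simp add: field_simps del: One_nat_def)
  have inv_v: "sym4 v * (\<Sum>n=1..4. 1 / v n) = sym3 v"
    unfolding sum_1_4 sym3_def sym4_def
    using uv[of 1] uv[of 2] uv[of 3] uv[of 4] by (simp add: field_simps del: One_nat_def)
  have 1: "(\<Prod>n=1..4. x - q_power lq (h n + 1/2) * t n) = (\<Prod>n=1..4. x - Q * u n)"
    by (simp add: q_power_add u_def Q_def mult_ac)
  have 2: "(\<Prod>n=1..4. x - q_power lq (l n - 1/2) * t n) = (\<Prod>n=1..4. x - 1 / Q * v n)"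
    by (simp add: q_power_diff v_def Q_def mult_ac)
  have 3: "q_power lq (2 * \<alpha> + 1) = A\<^sup>2 * Q\<^sup>2"
    by (simp add: q_power_add q_power_double q_power_half q_power_1 A_def Q_def)
  have 4: "q_power lq (\<alpha> + 1/2) = A * Q"
    by (simp add: q_power_add A_def Q_def)
  have 5: "(\<Sum>n=1..4. (q_power lq (h n) + q_power lq (l n)) * t n * x) = (sym1 u + sym1 v) * x"
    unfolding sum_1_4 sym1_def u_def v_def by (simp add: algebra_simps del: One_nat_def)
  have 6: "(\<Sum>n=1..4. (1 / (q_power lq (h n) * t n) + 1 / (q_power lq (l n) * t n)) / x)
      = ((\<Sum>n=1..4. 1 / u n) + (\<Sum>n=1..4. 1 / v n)) / x"
    by (simp add: u_def v_def sum.distrib flip: sum_divide_distrib)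
  have 7: "X * sym4 u * ((\<Sum>n=1..4. 1 / u n) + (\<Sum>n=1..4. 1 / v n)) = X * sym3 u + sym3 v / X"
    unfolding inv_u[symmetric] inv_v[symmetric] e4 using X by (simp add: field_simps power2_eq_square)
  have 8: "X * sym4 u * (- (Q + 1 / Q) / x^2 + ((\<Sum>n=1..4. 1 / u n) + (\<Sum>n=1..4. 1 / v n)) / x)
     = (X * sym3 u + sym3 v / X) / x - (Q + 1 / Q) * X * sym4 u / x\<^sup>2"
    unfolding 7[symmetric] by (simp add: algebra_simps add_divide_distrib diff_divide_distrib)
  have 9: "q_power lq (- 1/2) = 1 / Q"
    using q_power_minus[of lq "1/2"] by (simp add: Q_def)
  show ?thesis
    unfolding A2_def 1 2 3 4 5 6 9 R Q_def[symmetric] heun_shift_def heun_mid_def 8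
    by (simp add: algebra_simps)
qed

section \<open>The kernel identity\<close>

text \<open>
  With \<open>z = s / x\<close>, the products \<open>P\<^sub>1\<close>, \<open>P\<^sub>0\<close>, \<open>P\<^sub>2\<close> are proportional to the kernel at \<open>(x, q s)\<close>,
  \<open>(x, s)\<close>, \<open>(x, s / q)\<close>.  After removal of the common factor and of powers of \<open>q\<close>,
  the left side is the operator in \<open>x\<close> with the new parameters applied to the kernel, the right side
  the formal adjoint of the operator in \<open>s\<close> with the old ones.  Both sides are
  linear in the symmetric polynomials, and the coefficients agree one by one.  For instance, that of
  \<open>sym3 u\<close> is \<open>Q M\<^sup>2 X\<^sup>2\<close> times \<open>(P\<^sub>0 - P\<^sub>1) / s\<close> on the right and times \<open>M (P\<^sub>0 - Q\<^sup>2 X P\<^sub>1) / x\<close> on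
  the left, and both quotients are \<open>M (1 - Q\<^sup>2 X) (1 - M z / Q\<^sup>2) / x\<close>.
\<close>

lemma kernel_coefficient_identity:
  fixes u v :: "nat \<Rightarrow> complex"
  assumes nz: "Q \<noteq> 0" "M \<noteq> 0" "X \<noteq> 0" "x \<noteq> 0" "z \<noteq> 0"
    and e4: "sym4 v = X\<^sup>2 * sym4 u"
  defines "P\<^sub>1 \<equiv> (1 - M * z / Q\<^sup>2) * (1 - M * z)"
    and "P\<^sub>0 \<equiv> (1 - Q\<^sup>2 * M * X * z) * (1 - M * z / Q\<^sup>2)"
    and "P\<^sub>2 \<equiv> (1 - M * X * z) * (1 - Q\<^sup>2 * M * X * z)"
  shows "heun_shift Q (\<lambda>n. M * X * u n) x * P\<^sub>1 + Q\<^sup>2 * heun_shift (1 / Q) (\<lambda>n. M * v n) x * P\<^sub>2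
         + Q * heun_mid Q (1 / X) (\<lambda>n. M * X * u n) (\<lambda>n. M * v n) x * P\<^sub>0
       = M\<^sup>2 * X * (X * heun_shift Q u (Q\<^sup>2 * (z * x)) * P\<^sub>1
         + Q\<^sup>2 / X * heun_shift (1 / Q) v (z * x / Q\<^sup>2) * P\<^sub>2 + Q * heun_mid Q X u v (z * x) * P\<^sub>0)"
proof -
  have scale: "sym1 (\<lambda>n. c * w n) = c * sym1 w" "sym2 (\<lambda>n. c * w n) = c\<^sup>2 * sym2 w"
     "sym3 (\<lambda>n. c * w n) = c ^ 3 * sym3 w" "sym4 (\<lambda>n. c * w n) = c ^ 4 * sym4 w" for c w
    unfolding sym1_def sym2_def sym3_def sym4_def by algebra+
  show ?thesis
    unfolding heun_shift_def heun_mid_def prod_linear_factors scale e4 P\<^sub>1_def P\<^sub>2_def P\<^sub>0_def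
    using nz by (simp add: divide_simps) algebra
qed

text \<open>
  The kernel depends on \<open>s / x\<close> alone, so a shift of \<open>x\<close> is an opposite shift of \<open>s\<close>.
\<close>

lemma kernel_P1_shift:
  assumes "exp lq = q" "q \<noteq> 0"
  shows "kernel_P1 lq \<mu> \<mu>\<^sub>0 (x / q) s = kernel_P1 lq \<mu> \<mu>\<^sub>0 x (q * s)"
    and "kernel_P1 lq \<mu> \<mu>\<^sub>0 (q * x) s = kernel_P1 lq \<mu> \<mu>\<^sub>0 x (s / q)"
  using assms by (simp_all add: kernel_P1_def mult_ac divide_simps)

text \<open>
  Three neighbouring values of the kernel have the common factor
  \<open>(q a; q)\<^sub>\<infinity> / (b / q; q)\<^sub>\<infinity>\<close> and are polynomial multiples of it.  A common factor, rather than a ratio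
  of neighbours, also covers the points where the numerator of the kernel vanishes.
\<close>

lemma kernel_P1_contiguous:
  fixes q lq \<mu> \<mu>\<^sub>0 x s
  defines "a \<equiv> q_power lq \<mu> * s / x" and "b \<equiv> q_power lq \<mu>\<^sub>0 * s / x"
  assumes q: "exp lq = q" "norm q < 1"
    and nz: "q_poch_inf (b / q) q \<noteq> 0"
  shows "\<exists>U. kernel_P1 lq \<mu> \<mu>\<^sub>0 x (q * s) = U * ((1 - b / q) * (1 - b))
           \<and> kernel_P1 lq \<mu> \<mu>\<^sub>0 x s = U * ((1 - a) * (1 - b / q))
           \<and> kernel_P1 lq \<mu> \<mu>\<^sub>0 x (s / q) = U * ((1 - a / q) * (1 - a))"
proof -
  have q0: "q \<noteq> 0"
    using q by auto
  have two_steps: "q_poch_inf (c / q) q = (1 - c / q) * q_poch_inf c q"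
      "q_poch_inf c q = (1 - c) * q_poch_inf (q * c) q" for c
    using q_poch_inf_step[OF q(2), of "c / q"] q_poch_inf_step[OF q(2), of c] q0 by simp_all
  have K: "kernel_P1 lq \<mu> \<mu>\<^sub>0 x (q * s) = q_poch_inf (q * a) q / q_poch_inf (q * b) q"
    "kernel_P1 lq \<mu> \<mu>\<^sub>0 x s = q_poch_inf a q / q_poch_inf b q"
    "kernel_P1 lq \<mu> \<mu>\<^sub>0 x (s / q) = q_poch_inf (a / q) q / q_poch_inf (b / q) q"
    using q by (simp_all add: kernel_P1_def a_def b_def mult_ac)
  have common: "\<exists>U. A3 / B3 = U * (B1 * B2) \<and> A2 * A3 / (B2 * B3) = U * (A2 * B1)
      \<and> A1 * (A2 * A3) / (B1 * (B2 * B3)) = U * (A1 * A2)"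
    if "B1 * (B2 * B3) \<noteq> 0" for A1 A2 A3 B1 B2 B3 :: complex
    by (intro exI[of _ "A3 / (B1 * (B2 * B3))"]) (use that in \<open>simp add: field_simps\<close>)
  show ?thesis
    unfolding K two_steps(1) two_steps(2)[of a] two_steps(2)[of b]
    using nz unfolding two_steps(1) two_steps(2)[of b] by (rule common)
qed

section \<open>Decay along the lattice\<close>

lemma filterlim_int_shift_at_top: "filterlim (\<lambda>n::int. n + k) at_top at_top"
  unfolding filterlim_at_top
proof
  fix Z :: int
  show "\<forall>\<^sub>F n in at_top. Z \<le> n + k"
    using eventually_ge_at_top[of "Z - k"] by eventually_elim simp
qed

lemma filterlim_int_shift_at_bot: "filterlim (\<lambda>n::int. n + k) at_bot at_bot"
  unfolding filterlim_at_bot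
proof
  fix Z :: int
  show "\<forall>\<^sub>F n in at_bot. n + k \<le> Z"
    using eventually_le_at_bot[of "Z - k"] by eventually_elim simp
qed

lemma lattice_tendsto_0:
  fixes q :: complex
  assumes "norm q < 1"
  shows "((\<lambda>n. q powi n * c) \<longlongrightarrow> 0) at_top"
  unfolding tendsto_int_at_top_iff
  using tendsto_mult_left_zero[OF LIMSEQ_power_zero[OF assms]] by simp

lemma lattice_inverse_tendsto_0:
  fixes q :: complex
  assumes "norm q < 1"
  shows "((\<lambda>n. c / (q powi n)) \<longlongrightarrow> 0) at_bot"
  unfolding tendsto_int_at_bot_iff
  using tendsto_mult_right_zero[OF LIMSEQ_power_zero[OF assms], of c] 
  by (simp add: power_int_minus divide_inverse)

text \<open>
  A shift coefficient grows like \<open>s\<^sup>2\<close> at infinity and like \<open>1 / s\<^sup>2\<close> at zero.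
\<close>

lemma heun_shift_lattice_at_top:
  fixes q :: complex
  assumes "q \<noteq> 0" "norm q < 1" "\<xi> \<noteq> 0"
  shows "((\<lambda>n. heun_shift c u (q powi n * \<xi>) * (q powi n * \<xi>)\<^sup>2) \<longlongrightarrow> (\<Prod>i=1..4. 0 - c * u i)) at_top"
proof -
  have "((\<lambda>n. \<Prod>i=1..4. q powi n * \<xi> - c * u i) \<longlongrightarrow> (\<Prod>i=1..4. 0 - c * u i)) at_top"
    by (intro tendsto_prod tendsto_diff tendsto_const lattice_tendsto_0 assms)
  then show ?thesis
    using assms by (simp add: heun_shift_def)
qed

lemma heun_shift_lattice_at_bot:
  fixes q :: complex
  assumes "q \<noteq> 0" "norm q < 1" "\<xi> \<noteq> 0"
  shows "((\<lambda>n. heun_shift c u (q powi n * \<xi>) / (q powi n * \<xi>)\<^sup>2) \<longlongrightarrow> 1) at_bot"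
proof -
  have "((\<lambda>n. \<Prod>i=1..4. 1 - c * u i / \<xi> / q powi n) \<longlongrightarrow> (\<Prod>i=1..(4::nat). 1 - 0)) at_bot"
    by (intro tendsto_prod tendsto_diff tendsto_const lattice_inverse_tendsto_0 assms)
  moreover have "(\<Prod>i=1..4. 1 - c * u i / \<xi> / q powi n)
      = heun_shift c u (q powi n * \<xi>) / (q powi n * \<xi>)\<^sup>2" for n
  proof -
    have "(\<Prod>i=1..4. 1 - c * u i / \<xi> / q powi n) = (\<Prod>i=1..4. (q powi n * \<xi> - c * u i) / (q powi n * \<xi>))"
      using assms by (intro prod.cong) (simp_all add: field_simps)
    also have "\<dots> = (\<Prod>i=1..4. q powi n * \<xi> - c * u i) / (q powi n * \<xi>) ^ 4"
      by (simp add: prod_dividef)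
    finally show ?thesis
      by (simp add: heun_shift_def flip: power_add)
  qed
  ultimately show ?thesis
    by simp
qed

text \<open>
  Near zero the kernel tends to 1, and \<open>s\<^sup>e\<close> times \<open>s\<^bsup>2 - e\<^esup>\<close> is \<open>s\<^sup>2\<close>.  The shifts
  \<open>j\<close> and \<open>k\<close> are allowed because both the integrand and the boundary terms pair values at neighbouring points.
\<close>

lemma kernel_integrand_at_top:
  fixes q lq \<xi> x \<mu> \<mu>\<^sub>0 e h lg
  defines "s \<equiv> \<lambda>n. q powi n * \<xi>"
  assumes q: "norm q < 1" "exp lq = q" and lg: "q_logarithm lq lg" and \<xi>: "\<xi> \<noteq> 0"
    and lim: "((\<lambda>n. h (s n) / branch_power lg (s n) (2 - e)) \<longlongrightarrow> 0) at_top"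
  shows "((\<lambda>n. branch_power lg (s n) e * kernel_P1 lq \<mu> \<mu>\<^sub>0 x (s (n + j)) * h (s (n + k)) / (s n)\<^sup>2)
    \<longlongrightarrow> 0) at_top"
proof -
  have q0: "q \<noteq> 0"
    using q by auto
  have s0: "s n \<noteq> 0" for n
    using q0 \<xi> by (simp add: s_def)
  have "((\<lambda>n. q_poch_inf (q powi n * (q_power lq \<mu> * \<xi> / x)) q
      / q_poch_inf (q powi n * (q_power lq \<mu>\<^sub>0 * \<xi> / x)) q) \<longlongrightarrow> 1 / 1) at_top"
    using q q0 by (intro tendsto_divide q_poch_inf_tendsto_1) auto
  then have "((\<lambda>n. kernel_P1 lq \<mu> \<mu>\<^sub>0 x (s n)) \<longlongrightarrow> 1) at_top"
    by (simp add: kernel_P1_def s_def q mult_ac)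
  from filterlim_compose[OF this filterlim_int_shift_at_top]
  have P: "((\<lambda>n. kernel_P1 lq \<mu> \<mu>\<^sub>0 x (s (n + j))) \<longlongrightarrow> 1) at_top" .
  have s_shift: "s (n + k) = q powi k * s n" for n k
    using q0 by (simp add: s_def power_int_add)
  have B: "branch_power lg (s (n + k)) (2 - e) = q_power lq (2 - e) powi k * ((s n)\<^sup>2 / branch_power lg (s n) e)" for n
    unfolding s_shift q(2)[symmetric] branch_power_powi[OF lg s0]
    using branch_power_add[of lg "s n" "2 - e" e] branch_power_2[OF lg s0, of n]
    by (simp add: field_simps)
  have "((\<lambda>n. q_power lq (2 - e) powi k * (kernel_P1 lq \<mu> \<mu>\<^sub>0 x (s (n + j))
        * (h (s (n + k)) / branch_power lg (s (n + k)) (2 - e)))) \<longlongrightarrow> q_power lq (2 - e) powi k * (1 * 0)) at_top"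
    by (intro tendsto_mult tendsto_const P filterlim_compose[OF lim filterlim_int_shift_at_top])
  moreover have "q_power lq (2 - e) powi k * (kernel_P1 lq \<mu> \<mu>\<^sub>0 x (s (n + j))
        * (h (s (n + k)) / branch_power lg (s (n + k)) (2 - e))) =
     branch_power lg (s n) e * kernel_P1 lq \<mu> \<mu>\<^sub>0 x (s (n + j)) * h (s (n + k)) / (s n)\<^sup>2" for n
    unfolding B using s0[of n] by (simp add: field_simps)
  ultimately show ?thesis
    by simp
qed

text \<open>
  Towards infinity the kernel behaves like \<open>s\<close> to the power \<open>\<mu>\<^sub>0 - \<mu>\<close>, so the decay of \<open>h\<close> leaves
  \<open>o(s\<^bsup>-2\<^esup>)\<close>.
\<close>

lemma kernel_integrand_at_bot:
  fixes q lq \<xi> x \<mu> \<mu>\<^sub>0 e h lg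
  defines "s \<equiv> \<lambda>n. q powi n * \<xi>"
  assumes q: "norm q < 1" "exp lq = q" and lg: "q_logarithm lq lg" and \<xi>: "\<xi> \<noteq> 0" and x: "x \<noteq> 0"
    and nz: "\<And>n. q_poch_inf (q_power lq \<mu>\<^sub>0 * s n / x) q \<noteq> 0"
    and lim: "((\<lambda>n. h (s n) / branch_power lg (s n) (\<mu> - \<mu>\<^sub>0 - e - 2)) \<longlongrightarrow> 0) at_bot"
  shows "((\<lambda>n. branch_power lg (s n) e * kernel_P1 lq \<mu> \<mu>\<^sub>0 x (s (n + j)) * h (s (n + k)) * (s n)\<^sup>2)
    \<longlongrightarrow> 0) at_bot"
proof -
  define d where "d = \<mu> - \<mu>\<^sub>0"
  have q0: "q \<noteq> 0"
    using q by auto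
  have s0: "s n \<noteq> 0" for n
    using q0 \<xi> by (simp add: s_def)
  have s_shift: "s (n + k) = q powi k * s n" for n k
    using q0 by (simp add: s_def power_int_add)
  have B: "branch_power lg (s (n + k)) c = q_power lq c powi k * branch_power lg (s n) c" for n k c
    unfolding s_shift q(2)[symmetric] by (rule branch_power_powi[OF lg s0])
  have "\<exists>c. ((\<lambda>n. q_poch_inf (q powi n * (q_power lq \<mu> * \<xi> / x)) q / q_poch_inf (q powi n * (q_power lq \<mu>\<^sub>0 * \<xi> / x)) q
      * ((q_power lq \<mu> * \<xi> / x) / (q_power lq \<mu>\<^sub>0 * \<xi> / x)) powi n) \<longlongrightarrow> c) at_bot"
    using q q0 x \<xi> nz by (intro q_poch_inf_ratio_at_bot) (auto simp: s_def mult_ac)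
  moreover have "(q_power lq \<mu> * \<xi> / x) / (q_power lq \<mu>\<^sub>0 * \<xi> / x) = q_power lq d"
    using \<xi> x by (simp add: d_def q_power_diff)
  ultimately obtain c where "((\<lambda>n. kernel_P1 lq \<mu> \<mu>\<^sub>0 x (s n) * q_power lq d powi n) \<longlongrightarrow> c) at_bot"
    by (auto simp add: kernel_P1_def s_def q mult_ac)
  then have "((\<lambda>n. kernel_P1 lq \<mu> \<mu>\<^sub>0 x (s n) * q_power lq d powi n * branch_power lg \<xi> d)
      \<longlongrightarrow> c * branch_power lg \<xi> d) at_bot"
    by (rule tendsto_mult_right)
  moreover have "branch_power lg (s n) d = q_power lq d powi n * branch_power lg \<xi> d" for n
    unfolding s_def q(2)[symmetric] by (rule branch_power_powi[OF lg \<xi>])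
  ultimately have "((\<lambda>n. kernel_P1 lq \<mu> \<mu>\<^sub>0 x (s n) * branch_power lg (s n) d) \<longlongrightarrow> c * branch_power lg \<xi> d) at_bot"
    by (simp add: mult.assoc)
  from filterlim_compose[OF this filterlim_int_shift_at_bot]
  have P: "((\<lambda>n. kernel_P1 lq \<mu> \<mu>\<^sub>0 x (s (n + j)) * branch_power lg (s (n + j)) d) \<longlongrightarrow> c * branch_power lg \<xi> d) at_bot" .
  define C where "C = q_power lq (d - e - 2) powi k / q_power lq d powi j"
  have "((\<lambda>n. C * (kernel_P1 lq \<mu> \<mu>\<^sub>0 x (s (n + j)) * branch_power lg (s (n + j)) d
        * (h (s (n + k)) / branch_power lg (s (n + k)) (d - e - 2)))) \<longlongrightarrow> C * (c * branch_power lg \<xi> d * 0)) at_bot"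
    using lim unfolding d_def[symmetric]
    by (intro tendsto_mult tendsto_const P) (rule filterlim_compose[OF _ filterlim_int_shift_at_bot])
  moreover have "C * (kernel_P1 lq \<mu> \<mu>\<^sub>0 x (s (n + j)) * branch_power lg (s (n + j)) d
        * (h (s (n + k)) / branch_power lg (s (n + k)) (d - e - 2))) =
     branch_power lg (s n) e * kernel_P1 lq \<mu> \<mu>\<^sub>0 x (s (n + j)) * h (s (n + k)) * (s n)\<^sup>2" for n
  proof -
    have "branch_power lg (s n) d = branch_power lg (s n) (d - e - 2) * branch_power lg (s n) e * (s n)\<^sup>2"
      unfolding branch_power_2[OF lg s0, symmetric] branch_power_add[symmetric] by simp
    then show ?thesis
      unfolding B C_def by (simp add: field_simps)
  qed
  ultimately show ?thesis
    by simp
qed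

section \<open>Summation by parts\<close>

text \<open>
  The analytic core, on one lattice and with the equation for \<open>h\<close> in normal form.  The sums with
  kernel arguments \<open>n + 1\<close>, \<open>n\<close>, \<open>n - 1\<close> are the integrals for \<open>x / q\<close>, \<open>x\<close>, \<open>q x\<close>.  Multiplying the
  kernel identity by \<open>w n * h (s n)\<close> and eliminating the multiplication term with the equation for \<open>h\<close>
  turns the combination into a difference in \<open>n\<close>.  Its boundary terms \<open>G\<close> and \<open>H\<close> contain a coefficient
  of order \<open>s\<^bsup>-2\<^esup>\<close> at zero and \<open>s\<^sup>2\<close> at infinity, which the decay of the integrand just compensates.
\<close>

lemma lattice_sums_contiguous:
  fixes q lq \<xi> x \<mu> \<mu>\<^sub>0 e \<alpha>' chi E' h lg u v
  defines "Q \<equiv> q_power lq (1/2)" and "M \<equiv> q_power lq \<mu>\<^sub>0" and "X \<equiv> q_power lq chi"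
    and "A' \<equiv> q_power lq \<alpha>'"
    and "s \<equiv> \<lambda>n. q powi n * \<xi>"
  defines "w \<equiv> \<lambda>n. branch_power lg (s n) (chi + \<alpha>')"
    and "p \<equiv> \<lambda>n. kernel_P1 lq \<mu> \<mu>\<^sub>0 x (s n)"
  assumes q: "norm q < 1" "exp lq = q" and lg: "q_logarithm lq lg" and \<xi>: "\<xi> \<noteq> 0" and x: "x \<noteq> 0"
    and \<mu>: "\<mu> = \<mu>\<^sub>0 + 1 + chi"
    and nz: "\<And>n. q_poch_inf (q_power lq \<mu>\<^sub>0 * s n / x) q \<noteq> 0"
    and e4: "sym4 v = X\<^sup>2 * sym4 u"
    and h_eq: "\<And>n. heun_shift Q u (s n) * h (s (n - 1))
        + A'\<^sup>2 * Q\<^sup>2 * heun_shift (1 / Q) v (s n) * h (s (n + 1))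
        + A' * Q * heun_mid Q X u v (s n) * h (s n) = E' * h (s n)"
    and top: "((\<lambda>n. h (s n) / branch_power lg (s n) (2 - (chi + \<alpha>'))) \<longlongrightarrow> 0) at_top"
    and bot: "((\<lambda>n. h (s n) / branch_power lg (s n) (- \<alpha>' - 1)) \<longlongrightarrow> 0) at_bot"
  shows "\<And>j. (\<lambda>n. w n * p (n + j) * h (s n)) summable_on UNIV" (is "\<And>j. ?f j summable_on _")
    and "heun_shift Q (\<lambda>n. M * X * u n) x * (\<Sum>\<^sub>\<infinity>n. w n * p (n + 1) * h (s n))
       + Q\<^sup>2 * heun_shift (1 / Q) (\<lambda>n. M * v n) x * (\<Sum>\<^sub>\<infinity>n. w n * p (n - 1) * h (s n))
       + Q * heun_mid Q (1 / X) (\<lambda>n. M * X * u n) (\<lambda>n. M * v n) x * (\<Sum>\<^sub>\<infinity>n. w n * p n * h (s n))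
       = M\<^sup>2 * X / A' * E' * (\<Sum>\<^sub>\<infinity>n. w n * p n * h (s n))" (is "?lhs = _")
proof -
  have q0: "q \<noteq> 0"
    using q by auto
  have s0: "s n \<noteq> 0" for n
    using q0 \<xi> by (simp add: s_def)
  have nz_params: "Q \<noteq> 0" "M \<noteq> 0" "X \<noteq> 0" "A' \<noteq> 0"
    by (simp_all add: Q_def M_def X_def A'_def)
  have Q2: "Q\<^sup>2 = q"
    by (simp add: Q_def q_power_half q)
  have s_up: "s (n + 1) = q * s n" and s_down: "s (n - 1) = s n / q" for n
    using q0 by (simp_all add: s_def power_int_add power_int_diff)
  have w_up: "w (n + 1) = X * A' * w n" and w_down: "w (n - 1) = w n / (X * A')" for n
    using branch_power_q_shift[OF lg s0, of n "chi + \<alpha>'"]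
    by (simp_all add: w_def s_up s_down q q_power_add q_power_minus q_power_diff X_def A'_def)
  have w_top: "((\<lambda>n. w n * p (n + j) * h (s (n + k)) / (s n)\<^sup>2) \<longlongrightarrow> 0) at_top" for j k
    unfolding w_def p_def using kernel_integrand_at_top[OF q lg \<xi>] top by (simp add: s_def)
  have w_bot: "((\<lambda>n. w n * p (n + j) * h (s (n + k)) * (s n)\<^sup>2) \<longlongrightarrow> 0) at_bot" for j k
  proof -
    have "\<mu> - \<mu>\<^sub>0 - (chi + \<alpha>') - 2 = - \<alpha>' - 1"
      by (simp add: \<mu>)
    with bot have "((\<lambda>n. h (s n) / branch_power lg (s n) (\<mu> - \<mu>\<^sub>0 - (chi + \<alpha>') - 2)) \<longlongrightarrow> 0) at_bot"
      by (simp only:)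
    with nz show ?thesis
      unfolding w_def p_def s_def by (intro kernel_integrand_at_bot[OF q lg \<xi> x])
  qed
  show summable: "?f j summable_on UNIV" for j
  proof (rule bilateral_summable_on[where r = "q\<^sup>2"])
    show "q\<^sup>2 \<noteq> 0" "norm (q\<^sup>2) < 1"
      using q q0 by (auto simp: norm_power power_less_one_iff)
    have s2: "(q\<^sup>2) powi n = (s n)\<^sup>2 / \<xi>\<^sup>2" for n
      using \<xi> by (simp add: s_def power_mult_distrib power2_eq_square power_int_mult_distrib)
    show "((\<lambda>n. ?f j n / (q\<^sup>2) powi n) \<longlongrightarrow> 0) at_top"
      unfolding s2 using tendsto_mult_right_zero[OF w_top[of j 0], of "\<xi>\<^sup>2"] \<xi> by (simp add: mult_ac)
    show "((\<lambda>n. ?f j n * (q\<^sup>2) powi n) \<longlongrightarrow> 0) at_bot"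
      unfolding s2 using tendsto_mult_right_zero[OF w_bot[of j 0], of "1 / \<xi>\<^sup>2"] \<xi> by (simp add: mult_ac)
  qed
  define a where "a n = heun_shift Q u (s n)" for n
  define b where "b n = A'\<^sup>2 * Q\<^sup>2 * heun_shift (1 / Q) v (s n)" for n
  define G where "G n = w n * a n * p n * h (s (n - 1))" for n
  define H where "H n = w n * b n * p n * h (s (n + 1))" for n
  \<comment> \<open>The decay of the integrand is used up exactly by the growth of the shift coefficient.\<close>
  have boundary: "((\<lambda>n. w n * (k * heun_shift c y (s n)) * p n * h (s (n + i))) \<longlongrightarrow> 0) F"
    if "F = at_top \<or> F = at_bot" for F k c y i
    using that
  proof
    assume F: "F = at_top"
    have "((\<lambda>n. k * (heun_shift c y (s n) * (s n)\<^sup>2 * (w n * p (n + 0) * h (s (n + i)) / (s n)\<^sup>2)))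
        \<longlongrightarrow> k * ((\<Prod>i=1..4. 0 - c * y i) * 0)) at_top"
      unfolding s_def by (intro tendsto_mult tendsto_const heun_shift_lattice_at_top q q0 \<xi> w_top[unfolded s_def])
    then show ?thesis
      using s0 by (simp add: F mult_ac)
  next
    assume F: "F = at_bot"
    have "((\<lambda>n. k * (heun_shift c y (s n) / (s n)\<^sup>2 * (w n * p (n + 0) * h (s (n + i)) * (s n)\<^sup>2)))
        \<longlongrightarrow> k * (1 * 0)) at_bot"
      unfolding s_def by (intro tendsto_mult tendsto_const heun_shift_lattice_at_bot q q0 \<xi> w_bot[unfolded s_def])
    then show ?thesis
      using s0 by (simp add: F mult_ac)
  qed
  have G_lim: "(G \<longlongrightarrow> 0) at_top" "(G \<longlongrightarrow> 0) at_bot"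
    unfolding G_def a_def using boundary[of _ 1 Q u "-1"] by auto
  have "(H \<longlongrightarrow> 0) at_top" "(H \<longlongrightarrow> 0) at_bot"
    unfolding H_def b_def using boundary[of _ "A'\<^sup>2 * Q\<^sup>2" "1 / Q" v 1] by auto
  from filterlim_compose[OF this(1) filterlim_int_shift_at_top[of "-1"]]
    filterlim_compose[OF this(2) filterlim_int_shift_at_bot[of "-1"]]
  have H_lim: "((\<lambda>n. H (n - 1)) \<longlongrightarrow> 0) at_top" "((\<lambda>n. H (n - 1)) \<longlongrightarrow> 0) at_bot"
    by simp_all
  \<comment> \<open>\<open>K A' = M\<^sup>2 X\<close> is the factor in the kernel identity; \<open>E\<close> is \<open>q\<^bsup>\<alpha>\<^esup> K E'\<close>.\<close>
  define K where "K = M\<^sup>2 * X / A'"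
  define c1 where "c1 = heun_shift Q (\<lambda>n. M * X * u n) x"
  define c2 where "c2 = Q\<^sup>2 * heun_shift (1 / Q) (\<lambda>n. M * v n) x"
  define c0 where "c0 = Q * heun_mid Q (1 / X) (\<lambda>n. M * X * u n) (\<lambda>n. M * v n) x"
  have kernel: "c1 * p (n + 1) + c2 * p (n - 1) + c0 * p n =
      K * (X * A' * a (n + 1) * p (n + 1) + b (n - 1) / (X * A') * p (n - 1)
           + A' * Q * heun_mid Q X u v (s n) * p n)" for n
  proof -
    define z where "z = s n / x"
    have z: "z \<noteq> 0" "s n = z * x"
      using s0 x by (simp_all add: z_def)
    have MX: "q_power lq \<mu> * s n / x = Q\<^sup>2 * M * X * z" "q_power lq \<mu>\<^sub>0 * s n / x = M * z"
      by (simp_all add: \<mu> q_power_add q_power_1 q Q2 M_def X_def z_def)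
    have cancel: "Q\<^sup>2 * M * X * z / Q\<^sup>2 = M * X * z"
      using nz_params by simp
    have "q_poch_inf (q_power lq \<mu>\<^sub>0 * s n / x / q) q \<noteq> 0"
      using nz[of "n - 1"] by (simp add: s_down mult.commute)
    from kernel_P1_contiguous[OF q(2,1) this, of \<mu>]
    obtain U where U: "p (n + 1) = U * ((1 - M * z / Q\<^sup>2) * (1 - M * z))"
      "p n = U * ((1 - Q\<^sup>2 * M * X * z) * (1 - M * z / Q\<^sup>2))"
      "p (n - 1) = U * ((1 - M * X * z) * (1 - Q\<^sup>2 * M * X * z))"
      unfolding MX p_def s_up s_down Q2[symmetric] cancel by blast
    have b: "b (n - 1) / (X * A') = A' * (Q\<^sup>2 / X * heun_shift (1 / Q) v (z * x / Q\<^sup>2))"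
      unfolding b_def s_down z(2) Q2[symmetric]
      using nz_params by (simp add: power2_eq_square field_simps)
    have a: "a (n + 1) = heun_shift Q u (Q\<^sup>2 * (z * x))"
      by (simp add: a_def s_up Q2 z)
    have KA: "M\<^sup>2 * X = K * A'"
      using nz_params by (simp add: K_def)
    have "c1 * p (n + 1) + c2 * p (n - 1) + c0 * p n = U * (M\<^sup>2 * X *
        (X * heun_shift Q u (Q\<^sup>2 * (z * x)) * ((1 - M * z / Q\<^sup>2) * (1 - M * z))
         + Q\<^sup>2 / X * heun_shift (1 / Q) v (z * x / Q\<^sup>2) * ((1 - M * X * z) * (1 - Q\<^sup>2 * M * X * z))
         + Q * heun_mid Q X u v (z * x) * ((1 - Q\<^sup>2 * M * X * z) * (1 - M * z / Q\<^sup>2))))"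
      unfolding kernel_coefficient_identity[OF nz_params(1-3) x z(1) e4, symmetric] U c1_def c2_def c0_def
      by (simp only: distrib_left mult_ac)
    also have "\<dots> = K * (X * A' * a (n + 1) * p (n + 1) + b (n - 1) / (X * A') * p (n - 1)
           + A' * Q * heun_mid Q X u v (s n) * p n)"
      unfolding KA a b z(2) U by (simp only: distrib_left mult_ac)
    finally show ?thesis .
  qed
  \<comment> \<open>The index of \<open>H\<close> is lowered because the two boundary terms telescope in opposite directions.\<close>
  define G' where "G' n = K * (G n - H (n - 1))" for n
  define D where "D n = c1 * ?f 1 n + c2 * ?f (- 1) n + (c0 - K * E') * ?f 0 n" for n
  have tele: "D n = G' (n + 1) - G' n" for n
  proof -
    have "D n = w n * h (s n) * (c1 * p (n + 1) + c2 * p (n - 1) + c0 * p n) - K * w n * p n * (E' * h (s n))"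
      unfolding D_def by (simp add: algebra_simps)
    also have "\<dots> = K * (X * A' * w n * a (n + 1) * p (n + 1) * h (s n)
        + w n / (X * A') * b (n - 1) * p (n - 1) * h (s n)
        - w n * a n * p n * h (s (n - 1)) - w n * b n * p n * h (s (n + 1)))"
      unfolding kernel h_eq[symmetric] a_def b_def by (simp add: algebra_simps)
    also have "\<dots> = K * (G (n + 1) + H (n - 1) - G n - H n)"
      unfolding G_def H_def w_up w_down by (simp add: mult_ac)
    finally show ?thesis
      by (simp add: G'_def algebra_simps)
  qed
  have "(D has_sum (c1 * infsum (?f 1) UNIV + c2 * infsum (?f (- 1)) UNIV + (c0 - K * E') * infsum (?f 0) UNIV)) UNIV"
    unfolding D_def by (intro has_sum_add has_sum_cmult_right has_sum_infsum summable)
  moreover have "(G' \<longlongrightarrow> K * (0 - 0)) at_top" "(G' \<longlongrightarrow> K * (0 - 0)) at_bot"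
    unfolding G'_def by (intro tendsto_mult tendsto_diff tendsto_const G_lim H_lim)+
  ultimately have "c1 * infsum (?f 1) UNIV + c2 * infsum (?f (- 1)) UNIV + (c0 - K * E') * infsum (?f 0) UNIV = 0"
    by (intro bilateral_telescoping[where f = D and G = G', OF _ tele]) simp_all
  then show "?lhs = M\<^sup>2 * X / A' * E' * (\<Sum>\<^sub>\<infinity>n. w n * p n * h (s n))"
    by (simp add: c1_def c2_def c0_def K_def algebra_simps)
qed

section \<open>The transformed equation\<close>

lemma jackson_integral_shift:
  assumes "q \<noteq> 0"
  shows "jackson_integral q (q * \<xi>) f = jackson_integral q \<xi> f"
proof -
  have "bij_betw (\<lambda>n::int. n + 1) UNIV UNIV"
    by (rule bij_betwI[where g = "\<lambda>n. n - 1"]) auto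
  from infsum_reindex_bij_betw[OF this, of "\<lambda>n. q powi n * \<xi> * f (q powi n * \<xi>)"]
  show ?thesis
    using assms by (simp add: jackson_integral_def power_int_add mult_ac)
qed

lemma q_invariant_powi:
  assumes S: "q_invariant q S" and q: "q \<noteq> 0" and \<xi>: "\<xi> \<in> S"
  shows "q powi n * \<xi> \<in> S"
proof (induction n rule: int_induct[where k = 0])
  case base
  then show ?case using \<xi> by simp
next
  case (step1 n)
  then show ?case
    using S q by (force simp: q_invariant_def power_int_add mult_ac)
next
  case (step2 n)
  then show ?case
    using S q by (force simp: q_invariant_def power_int_diff mult_ac)
qed

theorem theorem4p4:
  fixes q lq \<alpha>' \<mu>\<^sub>0 \<alpha> E' chi E \<mu> :: complex
    and lg \<xi> h g :: "complex \<Rightarrow> complex"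
    and t h' l' hh ll :: "nat \<Rightarrow> complex"
    and S D :: "complex set"
  assumes q: "0 < norm q" "norm q < 1" "exp lq = q"
    and lg: "q_logarithm lq lg"
    and t: "\<And>i. i \<in> {1..4} \<Longrightarrow> t i \<noteq> 0"
    and S: "q_invariant q S"
    and D: "q_invariant q D"
    and xi: "(\<exists>\<xi>\<^sub>0. \<xi>\<^sub>0 \<noteq> 0 \<and> (\<forall>x. \<xi> x = \<xi>\<^sub>0)) \<or> (\<exists>A. A \<noteq> 0 \<and> (\<forall>x. \<xi> x = A * x))"
    and xi_S: "\<And>x. x \<in> D \<Longrightarrow> \<xi> x \<in> S"
    and defined: "\<And>x n. x \<in> D \<Longrightarrow> q_poch_inf (q_power lq \<mu>\<^sub>0 * (q powi n * \<xi> x) / x) q \<noteq> 0"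
    and h_eq: "\<And>s. s \<in> S \<Longrightarrow> A2 lq t h' l' \<alpha>' h s = E' * h s"
    and lim_zero: "\<And>x. x \<in> D \<Longrightarrow>
      ((\<lambda>L::int. h (q powi L * \<xi> x) / branch_power lg (q powi L * \<xi> x)
          ((h' 1 + h' 2 + h' 3 + h' 4 - l' 1 - l' 2 - l' 3 - l' 4 - 2 * \<alpha>' + 4) / 2)) \<longlongrightarrow> 0) at_top"
    and lim_infinity: "\<And>x. x \<in> D \<Longrightarrow>
      ((\<lambda>K::int. h (q powi K * \<xi> x) / branch_power lg (q powi K * \<xi> x) (- \<alpha>' - 1)) \<longlongrightarrow> 0) at_bot"
    and chi_eq: "chi = (l' 1 + l' 2 + l' 3 + l' 4 - h' 1 - h' 2 - h' 3 - h' 4) / 2"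
    and E: "E = q_power lq (2 * \<mu>\<^sub>0 + \<alpha> - \<alpha>' + chi) * E'"
    and mu: "\<mu> = \<mu>\<^sub>0 + 1 + chi"
    and ll: "\<And>i. i \<in> {1..4} \<Longrightarrow> ll i = l' i + \<mu>\<^sub>0"
    and hh: "\<And>i. i \<in> {1..4} \<Longrightarrow> hh i = h' i + \<mu>\<^sub>0 + chi"
    and g: "\<And>x. g x = branch_power lg x (- \<alpha>) * jackson_integral q (\<xi> x)
      (\<lambda>s. branch_power lg s
             (- (h' 1 + h' 2 + h' 3 + h' 4 - l' 1 - l' 2 - l' 3 - l' 4 - 2 * \<alpha>' + 2) / 2)
           * h s * kernel_P1 lq \<mu> \<mu>\<^sub>0 x s)"
  shows "\<forall>x\<in>D.
      jackson_convergent q (\<xi> x)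
        (\<lambda>s. branch_power lg s
               (- (h' 1 + h' 2 + h' 3 + h' 4 - l' 1 - l' 2 - l' 3 - l' 4 - 2 * \<alpha>' + 2) / 2)
             * h s * kernel_P1 lq \<mu> \<mu>\<^sub>0 x s)
    \<and> A2 lq t hh ll \<alpha> g x = E * g x"
proof
  fix x
  assume xD: "x \<in> D"
  have q0: "q \<noteq> 0"
    using q by auto
  have x0: "x \<noteq> 0"
    using xD D by (auto simp: q_invariant_def)
  have xi0: "\<xi> x \<noteq> 0"
    using xi_S[OF xD] S by (auto simp: q_invariant_def)
  define s where "s n = q powi n * \<xi> x" for n
  define Q where "Q = q_power lq (1/2)"
  define X where "X = q_power lq chi"
  define M where "M = q_power lq \<mu>\<^sub>0"
  define A where "A = q_power lq \<alpha>"
  define A' where "A' = q_power lq \<alpha>'"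
  define u where "u n = q_power lq (h' n) * t n" for n
  define v where "v n = q_power lq (l' n) * t n" for n
  define w where "w n = branch_power lg (s n) (chi + \<alpha>')" for n
  define p where "p n = kernel_P1 lq \<mu> \<mu>\<^sub>0 x (s n)" for n
  define f where "f y = (\<lambda>s. branch_power lg s (chi + \<alpha>' - 1) * h s * kernel_P1 lq \<mu> \<mu>\<^sub>0 y s)" for y
  define T where "T j = (\<Sum>\<^sub>\<infinity>n. w n * p (n + j) * h (s n))" for j
  have s0: "s n \<noteq> 0" for n
    using q0 xi0 by (simp add: s_def)
  have s_up: "s (n + 1) = q * s n" and s_down: "s (n - 1) = s n / q" for n
    using q0 by (simp_all add: s_def power_int_add power_int_diff)
  have sS: "s n \<in> S" for n
    unfolding s_def by (rule q_invariant_powi[OF S q0 xi_S[OF xD]])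
  have nz_params: "Q \<noteq> 0" "X \<noteq> 0" "M \<noteq> 0" "A \<noteq> 0" "A' \<noteq> 0"
    by (simp_all add: Q_def X_def M_def A_def A'_def)
  have expo1: "(h' 1 + h' 2 + h' 3 + h' 4 - l' 1 - l' 2 - l' 3 - l' 4 - 2 * \<alpha>' + 4) / 2 = 2 - (chi + \<alpha>')"
    and expo2: "- (h' 1 + h' 2 + h' 3 + h' 4 - l' 1 - l' 2 - l' 3 - l' 4 - 2 * \<alpha>' + 2) / 2 = chi + \<alpha>' - 1"
    by (simp_all add: chi_eq field_simps)
  note sums = lattice_sums_contiguous[where q = q and lq = lq and \<xi> = "\<xi> x" and x = x and \<mu> = \<mu> and \<mu>\<^sub>0 = \<mu>\<^sub>0
      and \<alpha>' = \<alpha>' and chi = chi and E' = E' and h = h and lg = lg and u = u and v = v,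
      folded s_def Q_def X_def M_def A'_def, folded w_def p_def, OF q(2,3) lg xi0 x0 mu]
  have hyp: "q_poch_inf (M * s n / x) q \<noteq> 0"
    "sym4 v = X\<^sup>2 * sym4 u"
    "heun_shift Q u (s n) * h (s (n - 1)) + A'\<^sup>2 * Q\<^sup>2 * heun_shift (1 / Q) v (s n) * h (s (n + 1))
        + A' * Q * heun_mid Q X u v (s n) * h (s n) = E' * h (s n)"
    "((\<lambda>n. h (s n) / branch_power lg (s n) (2 - (chi + \<alpha>'))) \<longlongrightarrow> 0) at_top"
    "((\<lambda>n. h (s n) / branch_power lg (s n) (- \<alpha>' - 1)) \<longlongrightarrow> 0) at_bot" for n
  proof -
    show "q_poch_inf (M * s n / x) q \<noteq> 0"
      unfolding s_def M_def using defined[OF xD] .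
    show "sym4 v = X\<^sup>2 * sym4 u"
      unfolding v_def u_def X_def by (rule sym4_balance[OF chi_eq])
    show "heun_shift Q u (s n) * h (s (n - 1)) + A'\<^sup>2 * Q\<^sup>2 * heun_shift (1 / Q) v (s n) * h (s (n + 1))
        + A' * Q * heun_mid Q X u v (s n) * h (s n) = E' * h (s n)"
      using h_eq[OF sS[of n]] A2_normal_form[OF chi_eq t, where lq = lq and \<alpha> = \<alpha>' and f = h and x = "s n"]
      by (simp add: s_up s_down q Q_def X_def A'_def u_def[abs_def] v_def[abs_def])
    show "((\<lambda>n. h (s n) / branch_power lg (s n) (2 - (chi + \<alpha>'))) \<longlongrightarrow> 0) at_top"
      using lim_zero[OF xD] unfolding expo1 s_def .
    show "((\<lambda>n. h (s n) / branch_power lg (s n) (- \<alpha>' - 1)) \<longlongrightarrow> 0) at_bot"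
      using lim_infinity[OF xD] unfolding s_def .
  qed
  have summable: "(\<lambda>n. w n * p (n + j) * h (s n)) summable_on UNIV" for j
    by (rule sums(1)) (rule hyp)+
  have rel: "heun_shift Q (\<lambda>n. M * X * u n) x * T 1 + Q\<^sup>2 * heun_shift (1 / Q) (\<lambda>n. M * v n) x * T (- 1)
       + Q * heun_mid Q (1 / X) (\<lambda>n. M * X * u n) (\<lambda>n. M * v n) x * T 0 = M\<^sup>2 * X / A' * E' * T 0"
    unfolding T_def using sums(2)[OF hyp] by simp
  \<comment> \<open>The factor \<open>s\<close> of the Jackson measure raises the exponent of the weight by one.\<close>
  have w_eq: "s n * branch_power lg (s n) (chi + \<alpha>' - 1) = w n" for n
    using branch_power_add[of lg "s n" 1 "chi + \<alpha>' - 1"] branch_power_1[OF lg s0] by (simp add: w_def)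
  have summand: "s n * f x (s n) = w n * p n * h (s n)"
    "s n * f (x / q) (s n) = w n * p (n + 1) * h (s n)"
    "s n * f (q * x) (s n) = w n * p (n - 1) * h (s n)" for n
    unfolding f_def kernel_P1_shift[OF q(3) q0] w_eq[symmetric] p_def s_up s_down
    by (simp_all add: mult_ac)
  have J: "jackson_integral q (\<xi> x) (f x) = (1 - q) * T 0"
    "jackson_integral q (\<xi> x) (f (x / q)) = (1 - q) * T 1"
    "jackson_integral q (\<xi> x) (f (q * x)) = (1 - q) * T (- 1)"
    unfolding jackson_integral_def s_def[symmetric] summand T_def by simp_all
  \<comment> \<open>If \<open>\<xi> = A x\<close>, the shift of \<open>x\<close> moves the base point along the same lattice.\<close>
  have lattice: "jackson_integral q (\<xi> (q * x)) F = jackson_integral q (\<xi> x) F"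
    "jackson_integral q (\<xi> (x / q)) F = jackson_integral q (\<xi> x) F" for F
    using xi jackson_integral_shift[OF q0, of "\<xi> x" F] jackson_integral_shift[OF q0, of "\<xi> x / q" F] q0
    by (auto simp: mult_ac)
  define B where "B = branch_power lg x (- \<alpha>) * (1 - q)"
  have g_eq: "g y = branch_power lg y (- \<alpha>) * jackson_integral q (\<xi> y) (f y)" for y
    unfolding g f_def expo2 ..
  have gx: "g x = B * T 0"
    unfolding g_eq J B_def by simp
  have gd: "g (x / q) = A * B * T 1"
    unfolding g_eq lattice J B_def A_def
    using branch_power_q_shift(2)[OF lg x0, of "- \<alpha>"] by (simp add: q)
  have gu: "g (q * x) = 1 / A * B * T (- 1)"
    unfolding g_eq lattice J B_def A_def
    using branch_power_q_shift(1)[OF lg x0, of "- \<alpha>"] by (simp add: q q_power_minus)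
  \<comment> \<open>The new parameters have the opposite value of \<open>chi\<close>, hence \<open>1 / X\<close> in their normal form.\<close>
  have chi': "- chi = (ll 1 + ll 2 + ll 3 + ll 4 - hh 1 - hh 2 - hh 3 - hh 4) / 2"
    by (simp add: ll hh chi_eq field_simps)
  have uv': "heun_shift c (\<lambda>n. q_power lq (hh n) * t n) x = heun_shift c (\<lambda>n. M * X * u n) x"
    "heun_shift c (\<lambda>n. q_power lq (ll n) * t n) x = heun_shift c (\<lambda>n. M * v n) x"
    "heun_mid Q Y (\<lambda>n. q_power lq (hh n) * t n) (\<lambda>n. q_power lq (ll n) * t n) x
      = heun_mid Q Y (\<lambda>n. M * X * u n) (\<lambda>n. M * v n) x" for c Y
    by (simp_all add: heun_shift_def heun_mid_def prod_1_4 sym1_def sym2_def sym3_def sym4_def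
        ll hh q_power_add u_def v_def M_def X_def mult_ac)
  have X_inv: "q_power lq (- chi) = 1 / X"
    by (simp add: X_def q_power_minus)
  have "A2 lq t hh ll \<alpha> g x =
      heun_shift Q (\<lambda>n. q_power lq (hh n) * t n) x * g (x / exp lq)
      + A\<^sup>2 * Q\<^sup>2 * heun_shift (1 / Q) (\<lambda>n. q_power lq (ll n) * t n) x * g (exp lq * x)
      + A * Q * heun_mid Q (q_power lq (- chi)) (\<lambda>n. q_power lq (hh n) * t n) (\<lambda>n. q_power lq (ll n) * t n) x * g x"
    unfolding A_def Q_def by (rule A2_normal_form[OF chi' t])
  also have "\<dots> = heun_shift Q (\<lambda>n. M * X * u n) x * g (x / q)
      + A\<^sup>2 * Q\<^sup>2 * heun_shift (1 / Q) (\<lambda>n. M * v n) x * g (q * x)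
      + A * Q * heun_mid Q (1 / X) (\<lambda>n. M * X * u n) (\<lambda>n. M * v n) x * g x"
    unfolding uv' X_inv q(3) ..
  also have "\<dots> = A * B * (heun_shift Q (\<lambda>n. M * X * u n) x * T 1
      + Q\<^sup>2 * heun_shift (1 / Q) (\<lambda>n. M * v n) x * T (- 1)
      + Q * heun_mid Q (1 / X) (\<lambda>n. M * X * u n) (\<lambda>n. M * v n) x * T 0)"
    unfolding gx gd gu using nz_params(4) by (simp add: algebra_simps power2_eq_square)
  also have "\<dots> = E * g x"
    unfolding rel gx E
    by (simp add: q_power_add q_power_diff q_power_double M_def X_def A_def A'_def)
  finally have "A2 lq t hh ll \<alpha> g x = E * g x" .
  moreover have "jackson_convergent q (\<xi> x) (f x)"
    unfolding jackson_convergent_def s_def[symmetric] summand using summable[of 0] by simp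
  ultimately show "jackson_convergent q (\<xi> x)
        (\<lambda>s. branch_power lg s
               (- (h' 1 + h' 2 + h' 3 + h' 4 - l' 1 - l' 2 - l' 3 - l' 4 - 2 * \<alpha>' + 2) / 2)
             * h s * kernel_P1 lq \<mu> \<mu>\<^sub>0 x s)
    \<and> A2 lq t hh ll \<alpha> g x = E * g x"
    unfolding expo2 f_def by simp
qed

end
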